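(* Let $A=\{a,b,c\}$ and let $\sigma$ be an invertible substitution over $A$. There exists $w\in\Gamma_A$ with $w\in A^*$ or $w^{-1}\in A^*$ such that: (1) $I_w\circ\sigma$ is a simple substitution. (2) Furthermore, $w$ can be chosen so that, in addition to (1), either $w\in A^*$ and $w$ is a common suffix of $\sigma(a),\sigma(b),\sigma(c)$, or $w^{-1}\in A^*$ and $w^{-1}$ is a common prefix of $\sigma(a),\sigma(b),\sigma(c)$.
   Context: $A=\{a,b,c\}$ is a three-letter alphabet; $A^*$ is the free monoid on $A$ (unit: the empty word $\varepsilon$) and $\Gamma_A$ is the free group on $A$, with $A^*\subset\Gamma_A$. A substitution over $A$ is a monoid endomorphism $\sigma$ of $A^*$; it extends naturally to an endomorphism of $\Gamma_A$, and $\sigma$ is called invertible if this extension is an automorphism of $\Gamma_A$. An endomorphism $\sigma$ of $\Gamma_A$ is identified with the triple $(\sigma(a),\sigma(b),\sigma(c))$. For $z\in\Gamma_A$, $I_z$ is the inner automorphism $I_z(w)=zwz^{-1}$ of $\Gamma_A$. A substitution is called simple if it belongs to the submonoid (under composition) generated by $\pi_1=(b,a,c)$, $\pi_2=(c,b,a)$, $\phi_l=(ba,b,c)$, $\phi_r=(ab,b,c)$. Prefixes and suffixes of positive words are taken in $A^*$ in the usual sense; the empty word is allowed. *)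

theory Defs
  imports "HOL-Algebra.Group" "HOL-Library.Sublist"
begin

text \<open>The free group on a type: elements are the freely reduced words over signed letters, where
  \<open>(x, True)\<close> stands for the generator \<open>x\<close> and \<open>(x, False)\<close> for its inverse.\<close>

type_synonym 'a signed = "'a \<times> bool"

definition flip :: "'a signed \<Rightarrow> 'a signed" where
  "flip p = (fst p, \<not> snd p)"

fun reduced :: "'a signed list \<Rightarrow> bool" where
  "reduced (p # q # w) \<longleftrightarrow> q \<noteq> flip p \<and> reduced (q # w)"
| "reduced _ \<longleftrightarrow> True"

fun push :: "'a signed \<Rightarrow> 'a signed list \<Rightarrow> 'a signed list" where
  "push p [] = [p]"
| "push p (q # w) = (if q = flip p then w else p # q # w)"

definition free_reduce :: "'a signed list \<Rightarrow> 'a signed list" where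
  "free_reduce w = foldr push w []"

definition formal_inverse :: "'a signed list \<Rightarrow> 'a signed list" where
  "formal_inverse w = rev (map flip w)"

definition free_group :: "'a signed list monoid" where
  "free_group = \<lparr>carrier = {w. reduced w}, mult = (\<lambda>u v. free_reduce (u @ v)), one = []\<rparr>"

text \<open>The inclusion of the free monoid \<open>'a list\<close> into the free group.\<close>

definition pos :: "'a list \<Rightarrow> 'a signed list" where
  "pos u = map (\<lambda>x. (x, True)) u"

definition positive_words :: "'a signed list set" where
  "positive_words = range pos"

definition substitution :: "('a list \<Rightarrow> 'a list) \<Rightarrow> bool" where
  "substitution \<sigma> \<longleftrightarrow> \<sigma> [] = [] \<and> (\<forall>u v. \<sigma> (u @ v) = \<sigma> u @ \<sigma> v)"

definition free_extend :: "('a list \<Rightarrow> 'a list) \<Rightarrow> 'a signed list \<Rightarrow> 'a signed list" where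
  "free_extend \<sigma> w = free_reduce (concat (map
     (\<lambda>(x, s). if s then pos (\<sigma> [x]) else formal_inverse (pos (\<sigma> [x]))) w))"

definition invertible_substitution :: "('a list \<Rightarrow> 'a list) \<Rightarrow> bool" where
  "invertible_substitution \<sigma> \<longleftrightarrow> substitution \<sigma> \<and> free_extend \<sigma> \<in> iso free_group free_group"

definition inner_aut :: "'a signed list \<Rightarrow> 'a signed list \<Rightarrow> 'a signed list" where
  "inner_aut z w = z \<otimes>\<^bsub>free_group\<^esub> w \<otimes>\<^bsub>free_group\<^esub> inv\<^bsub>free_group\<^esub> z"

datatype letter = La | Lb | Lc

definition triple :: "letter list \<Rightarrow> letter list \<Rightarrow> letter list \<Rightarrow> letter list \<Rightarrow> letter list" where
  "triple u v w x = concat (map (case_letter u v w) x)"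

inductive_set simple_substitutions :: "(letter list \<Rightarrow> letter list) set" where
  simple_id: "id \<in> simple_substitutions"
| simple_pi1: "triple [Lb] [La] [Lc] \<in> simple_substitutions"
| simple_pi2: "triple [Lc] [Lb] [La] \<in> simple_substitutions"
| simple_phil: "triple [Lb, La] [Lb] [Lc] \<in> simple_substitutions"
| simple_phir: "triple [La, Lb] [Lb] [Lc] \<in> simple_substitutions"
| simple_comp: "\<sigma> \<in> simple_substitutions \<Longrightarrow> \<tau> \<in> simple_substitutions \<Longrightarrow>
    \<sigma> \<circ> \<tau> \<in> simple_substitutions"

text \<open>Endomorphisms of the free group are compared on its carrier only.\<close>

definition is_simple_substitution :: "(letter signed list \<Rightarrow> letter signed list) \<Rightarrow> bool" where
  "is_simple_substitution f \<longleftrightarrow>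
     (\<exists>\<tau>\<in>simple_substitutions. \<forall>x\<in>carrier free_group. f x = free_extend \<tau> x)"

text \<open>The structure above is a group, and \<open>free_extend\<close> is the unique homomorphism extending a
  substitution.\<close>

lemma flip_flip [simp]: "flip (flip p) = p"
  by (simp add: flip_def)

lemma reduced_tl: "reduced (p # w) \<Longrightarrow> reduced w"
  by (cases w) auto

lemma reduced_push: "reduced w \<Longrightarrow> reduced (push p w)"
  by (cases w) (auto dest: reduced_tl)

lemma reduced_foldr: "reduced r \<Longrightarrow> reduced (foldr push w r)"
  by (induction w) (auto intro: reduced_push)

lemma reduced_free_reduce [simp]: "reduced (free_reduce w)"
  by (simp add: free_reduce_def reduced_foldr)

lemma free_reduce_reduced: "reduced w \<Longrightarrow> free_reduce w = w"
proof (induction w)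
  case (Cons p w)
  then show ?case by (cases w) (auto simp: free_reduce_def)
qed (simp add: free_reduce_def)

lemma push_push_flip: "reduced r \<Longrightarrow> push p (push (flip p) r) = r"
proof (cases r)
  case (Cons q r')
  assume "reduced r"
  with Cons show ?thesis by (cases r') auto
qed simp

lemma foldr_push_push:
  "reduced r \<Longrightarrow> foldr push (push p u) r = push p (foldr push u r)"
proof (cases u)
  case (Cons q u')
  assume r: "reduced r"
  show ?thesis
  proof (cases "q = flip p")
    case True
    with Cons push_push_flip [OF reduced_foldr [OF r]] show ?thesis by simp
  qed (simp add: Cons)
qed simp

lemma foldr_push_free_reduce:
  "reduced r \<Longrightarrow> foldr push (free_reduce u) r = foldr push u r"
  unfolding free_reduce_def by (induction u) (simp_all add: foldr_push_push)

lemma free_reduce_append_left [simp]: "free_reduce (free_reduce u @ v) = free_reduce (u @ v)"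
  using foldr_push_free_reduce [of "foldr push v []" u]
  by (simp add: free_reduce_def reduced_foldr)

lemma free_reduce_append_right [simp]: "free_reduce (u @ free_reduce v) = free_reduce (u @ v)"
  using free_reduce_reduced [OF reduced_free_reduce, of v] by (simp add: free_reduce_def)

lemma free_reduce_cancel: "free_reduce (formal_inverse w @ w) = []"
proof (induction w)
  case (Cons p w)
  have "push (flip p) (push p (foldr push w [])) = foldr push w []"
    using push_push_flip [of "foldr push w []" "flip p"] by (simp add: reduced_foldr)
  with Cons show ?case by (simp add: formal_inverse_def free_reduce_def)
qed (simp add: formal_inverse_def free_reduce_def)

theorem group_free_group: "group (free_group :: 'a signed list monoid)"
proof (rule groupI)
  fix x :: "'a signed list"
  assume "x \<in> carrier free_group"
  show "\<exists>y\<in>carrier free_group. y \<otimes>\<^bsub>free_group\<^esub> x = \<one>\<^bsub>free_group\<^esub>"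
    by (rule bexI [of _ "free_reduce (formal_inverse x)"])
      (simp_all add: free_group_def free_reduce_cancel)
qed (auto simp: free_group_def free_reduce_reduced)

lemma pos_in_carrier: "pos u \<in> carrier free_group"
proof -
  have "reduced (map (\<lambda>x. (x, True)) u)"
    by (induction u rule: induct_list012) (auto simp: flip_def)
  then show ?thesis by (simp add: pos_def free_group_def)
qed

lemma pos_append: "pos (u @ v) = pos u \<otimes>\<^bsub>free_group\<^esub> pos v"
  using pos_in_carrier [of "u @ v"]
  by (simp add: free_group_def free_reduce_reduced pos_def)

lemma inj_pos: "inj pos"
  by (auto simp: inj_def pos_def inj_map_eq_map)

lemma free_extend_pos:
  assumes "substitution \<sigma>"
  shows "free_extend \<sigma> (pos u) = pos (\<sigma> u)"
proof -
  have "concat (map (\<lambda>x. pos (\<sigma> [x])) u) = pos (\<sigma> u)"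
  proof (induction u)
    case Nil
    then show ?case using assms by (simp add: substitution_def pos_def)
  next
    case (Cons x u)
    have "\<sigma> (x # u) = \<sigma> [x] @ \<sigma> u"
      using assms by (metis append_Cons append_Nil substitution_def)
    with Cons show ?case by (simp add: pos_def)
  qed
  then show ?thesis
    using pos_in_carrier [of "\<sigma> u"]
    by (simp add: free_extend_def pos_def [of u] comp_def free_reduce_reduced free_group_def)
qed

lemma formal_inverse_involutive [simp]: "formal_inverse (formal_inverse w) = w"
  by (simp add: formal_inverse_def rev_map comp_def)

lemma free_extend_free_reduce: "free_extend \<sigma> (free_reduce w) = free_extend \<sigma> w"
proof -
  define g where "g = (\<lambda>(x, s). if s then pos (\<sigma> [x]) else formal_inverse (pos (\<sigma> [x])))"
  have flip: "g (flip p) = formal_inverse (g p)" for p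
    by (cases p) (simp add: g_def flip_def)
  have cancel: "free_reduce (g p @ g (flip p) @ v) = free_reduce v" for p v
  proof -
    have "free_reduce (g p @ g (flip p)) = []"
      using free_reduce_cancel [of "g (flip p)"] by (simp add: flip)
    then show ?thesis
      by (metis append_Nil append_assoc free_reduce_append_left)
  qed
  have push: "free_reduce (concat (map g (push p w))) = free_reduce (concat (map g (p # w)))"
    for p w by (cases w) (auto simp: cancel)
  have "free_reduce (concat (map g (foldr push w []))) = free_reduce (concat (map g w))"
  proof (induction w)
    case (Cons p w)
    have "free_reduce (concat (map g (push p (foldr push w [])))) =
        free_reduce (g p @ free_reduce (concat (map g (foldr push w []))))"
      by (simp add: push)
    also have "\<dots> = free_reduce (g p @ concat (map g w))"
      by (simp only: Cons.IH free_reduce_append_right)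
    finally show ?case by simp
  qed simp
  then show ?thesis by (simp add: free_extend_def free_reduce_def [of w] g_def)
qed

theorem free_extend_hom: "free_extend \<sigma> \<in> hom free_group free_group"
proof (rule homI)
  fix u v :: "'a signed list"
  have "free_extend \<sigma> (u @ v) = free_reduce (free_extend \<sigma> u @ free_extend \<sigma> v)"
    by (simp add: free_extend_def)
  then show "free_extend \<sigma> (u \<otimes>\<^bsub>free_group\<^esub> v) =
      free_extend \<sigma> u \<otimes>\<^bsub>free_group\<^esub> free_extend \<sigma> v"
    using free_extend_free_reduce [of \<sigma> "u @ v"] by (simp add: free_group_def)
qed (simp add: free_group_def free_extend_def)

theorem hom_free_group_eqI:
  assumes f: "f \<in> hom free_group free_group" and h: "h \<in> hom free_group free_group"
    and eq: "\<And>x. f (pos [x]) = h (pos [x])" and w: "w \<in> carrier free_group"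
  shows "f w = h w"
proof -
  interpret G: group free_group by (rule group_free_group)
  interpret f: group_hom free_group free_group f
    by unfold_locales (rule f)
  interpret h: group_hom free_group free_group h
    by unfold_locales (rule h)
  have gen: "f [p] = h [p]" for p
  proof (cases "snd p")
    case True
    then show ?thesis using eq [of "fst p"] by (cases p) (simp add: pos_def)
  next
    case False
    then have p: "p = (fst p, False)" by (cases p) simp
    have "inv\<^bsub>free_group\<^esub> (pos [fst p]) = [p]"
      by (subst p, intro G.inv_equality) (simp_all add: free_group_def pos_def free_reduce_def flip_def)
    then show ?thesis
      using eq [of "fst p"] f.hom_inv h.hom_inv pos_in_carrier by metis
  qed
  have red: "reduced w" using w by (simp add: free_group_def)
  then show ?thesis
  proof (induction w)
    case Nil
    then show ?case using f.hom_one h.hom_one by (simp add: free_group_def)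
  next
    case (Cons p w)
    have c: "[p] \<in> carrier free_group" "w \<in> carrier free_group"
      using Cons.prems by (auto simp: free_group_def dest: reduced_tl)
    have "p # w = [p] \<otimes>\<^bsub>free_group\<^esub> w"
      using free_reduce_reduced [OF Cons.prems] by (simp add: free_group_def)
    then show ?case
      using Cons c gen f.hom_mult h.hom_mult by (metis reduced_tl)
  qed
qed

lemma substitution_triple: "substitution (triple u v w)"
  by (simp add: substitution_def triple_def)

lemma simple_substitution_substitution: "\<sigma> \<in> simple_substitutions \<Longrightarrow> substitution \<sigma>"
  by (induction rule: simple_substitutions.induct)
    (auto simp: substitution_triple, auto simp: substitution_def)

end

theory Submission
  imports Defs
begin

text \<open>
  Let \<open>\<sigma>\<close> be an invertible substitution. If \<open>\<sigma>(i)\<close> is a prefix of \<open>\<sigma>(j)\<close> for letters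
  \<open>i \<noteq> j\<close>, say \<open>\<sigma>(j) = \<sigma>(i) r\<close>, then \<open>\<sigma> = \<sigma>' \<circ> \<nu>\<close>, where \<open>\<nu>\<close> is the elementary map
  \<open>j \<mapsto> i j\<close> and \<open>\<sigma>'\<close>, which sends \<open>j\<close> to \<open>r\<close>, is shorter; likewise for suffixes. So the
  theorem follows by induction on \<open>|\<sigma>(a)| + |\<sigma>(b)| + |\<sigma>(c)|\<close>, provided that one of the positive
  conjugates of \<open>\<sigma>\<close> can be shortened in this way as long as \<open>\<sigma>\<close> does not permute the letters
  (\<open>simple_rotation_if_prefix\<close>, \<open>simple_rotation_if_suffix\<close>, \<open>ex_simple_rotation\<close>).

  Suppose that \<open>\<sigma>\<close> itself cannot be shortened at a prefix, and write \<open>\<sigma>(x) = p z\<^sub>x s\<close>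
  with \<open>p\<close> the longest common prefix of the three images and \<open>s\<close> the longest common suffix
  of the words \<open>z\<^sub>x s\<close>. The conjugates \<open>z\<^sub>x s p\<close> and \<open>s p z\<^sub>x\<close> are the
  two extreme ones. If neither the first can be shortened at a suffix nor the second at a prefix,
  then the words \<open>z\<^sub>x\<close> form both a prefix code and a suffix code, and neither their first nor their
  last letters are all equal. The core of the proof (\<open>generating_bifix_code\<close>) is that then
  \<open>s p z\<^sub>a, s p z\<^sub>b, s p z\<^sub>c\<close> cannot generate the free group unless \<open>s p\<close> is empty and the
  \<open>z\<^sub>x\<close> are letters, that is, unless \<open>\<sigma>\<close> permutes the letters.

  That core statement is an instance of Stallings' folding. The three words are closed paths at a base
  point of an explicit finite graph with letters on its edges, in which no two edges with the same
  letter start at, or end at, the same vertex. Each letter is then a partial injection of the vertices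
  and extends to a permutation. The three words fix the base point under this action of the free
  group. If they generate, every letter fixes the base point, so the graph has only loops of length
  one there. The common prefix of two of the words and the common suffix of two of them
  determine which graph to take; there are four shapes (\<open>generating_fork_chain\<close>,
  \<open>not_generating_overlap\<close>, \<open>generating_parallel_chains\<close>, \<open>not_generating_loop\<close>).

  Finally, a conjugation obtained for one of the extreme conjugates is carried back to \<open>\<sigma>\<close>. Two
  words that are common suffixes of the same images are comparable
  (\<open>rotates_common_target\<close>), and so are two common prefixes
  (\<open>rotates_common_source\<close>); hence the composed conjugation is again by a common prefix or by a
  common suffix.
\<close>

section \<open>Permutation actions of the free group\<close>

text \<open>
  The words in \<open>W\<close> generate a subgroup that lies in the stabiliser of a point iff they all fix
  that point. So this property holds for every set that generates the free group, and it speaks of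
  positive words only. The permuted set is \<open>nat \<times> 'a list\<close> because it holds
  all subdivided graphs used below: \<open>(a, w)\<close> is the vertex reached from \<open>(a, [])\<close> by
  reading \<open>w\<close> along an arc. Words act from left to right.
\<close>
definition generating :: "'a list set \<Rightarrow> bool" where
  "generating W \<longleftrightarrow> (\<forall>(\<rho> :: 'a \<Rightarrow> nat \<times> 'a list \<Rightarrow> nat \<times> 'a list) v.
     (\<forall>x. bij (\<rho> x)) \<longrightarrow> (\<forall>w\<in>W. fold \<rho> w v = v) \<longrightarrow> (\<forall>x. \<rho> x v = v))"

definition signed_action :: "('a \<Rightarrow> 'v \<Rightarrow> 'v) \<Rightarrow> 'a signed \<Rightarrow> 'v \<Rightarrow> 'v" where
  "signed_action \<rho> p = (if snd p then \<rho> (fst p) else inv_into UNIV (\<rho> (fst p)))"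

context
  fixes \<rho> :: "'a \<Rightarrow> 'v \<Rightarrow> 'v"
  assumes bij: "\<And>x. bij (\<rho> x)"
begin

lemma bij_fold: "bij (fold \<rho> w)"
proof (induction w)
  case (Cons x w)
  then show ?case using bij_comp[OF bij Cons] by (simp add: comp_def)
qed (simp add: bij_id[unfolded id_def])

lemma signed_action_flip: "signed_action \<rho> (flip p) (signed_action \<rho> p v) = v"
  using bij[of "fst p"]
  by (simp add: signed_action_def flip_def bij_is_inj bij_is_surj surj_f_inv_f)

lemma signed_action_push:
  "fold (signed_action \<rho>) (push p w) v = fold (signed_action \<rho>) (p # w) v"
  by (cases w) (auto simp: signed_action_flip)

lemma signed_action_free_reduce:
  "fold (signed_action \<rho>) (free_reduce w) v = fold (signed_action \<rho>) w v"
  unfolding free_reduce_def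
  by (induction w arbitrary: v) (auto simp: signed_action_push simp del: push.simps)

lemma signed_action_formal_inverse:
  "fold (signed_action \<rho>) (formal_inverse w) (fold (signed_action \<rho>) w v) = v"
  by (induction w arbitrary: v) (simp_all add: formal_inverse_def signed_action_flip)

lemma signed_action_pos: "fold (signed_action \<rho>) (pos w) v = fold \<rho> w v"
  by (induction w arbitrary: v) (simp_all add: pos_def signed_action_def)

lemma signed_action_free_extend:
  assumes "\<And>x. fold \<rho> (\<sigma> [x]) v = v"
  shows "fold (signed_action \<rho>) (free_extend \<sigma> w) v = v"
proof -
  have "fold (signed_action \<rho>) (formal_inverse (pos (\<sigma> [x]))) v = v" for x
    using signed_action_formal_inverse[of "pos (\<sigma> [x])" v] by (simp add: signed_action_pos assms)
  then have "fold (signed_action \<rho>) (concat (map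
     (\<lambda>(x, s). if s then pos (\<sigma> [x]) else formal_inverse (pos (\<sigma> [x]))) w)) v = v"
    by (induction w) (auto simp: signed_action_pos assms)
  then show ?thesis
    by (simp add: free_extend_def signed_action_free_reduce)
qed

end

text \<open>
  Surjectivity makes every letter the image of some group element, and all images fix the points
  that the words \<open>\<sigma>(x)\<close> fix.
\<close>
lemma generating_invertible:
  assumes "invertible_substitution \<sigma>"
  shows "generating (range (\<lambda>x. \<sigma> [x]))"
  unfolding generating_def
proof (intro allI impI)
  fix \<rho> :: "'a \<Rightarrow> nat \<times> 'a list \<Rightarrow> nat \<times> 'a list" and v x
  assume bij: "\<forall>x. bij (\<rho> x)" and fixed: "\<forall>w\<in>range (\<lambda>x. \<sigma> [x]). fold \<rho> w v = v"
  have "free_extend \<sigma> ` carrier free_group = carrier free_group"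
    using assms by (auto simp: invertible_substitution_def iso_def bij_betw_def)
  then obtain w where "pos [x] = free_extend \<sigma> w"
    using pos_in_carrier[of "[x]"] by (metis imageE)
  then have "fold (signed_action \<rho>) (pos [x]) v = v"
    using bij fixed by (simp add: signed_action_free_extend)
  then show "\<rho> x v = v"
    using bij by (simp add: signed_action_pos)
qed

lemma letter_UNIV: "(UNIV :: letter set) = {La, Lb, Lc}"
  by (auto intro: letter.exhaust)

definition toggle :: "nat \<times> 'a \<Rightarrow> nat \<times> 'a" where
  "toggle = (\<lambda>(n, w). (if n = 0 then 1 else if n = 1 then 0 else n, w))"

lemma toggle_toggle: "toggle (toggle p) = p"
  by (auto simp: toggle_def split: prod.splits if_splits)

lemma bij_toggle: "bij toggle"
  using involuntory_imp_bij[of toggle, OF toggle_toggle] .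

text \<open>
  The free group of rank three needs three generators: two vectors of \<open>\<int>\<^sub>2\<^sup>3\<close>, here the
  letter counts modulo 2, are annihilated by a nonzero linear form \<open>f\<close>. Let a letter \<open>x\<close>
  exchange two points iff \<open>f(x) = 1\<close>; both words then fix these points, but some letter does not.
\<close>
lemma not_generating_two:
  fixes u v :: "letter list"
  shows "\<not> generating {u, v}"
proof
  assume gen: "generating {u, v}"
  define odd_in :: "(letter \<Rightarrow> bool) \<Rightarrow> letter list \<Rightarrow> bool"
    where "odd_in f w \<longleftrightarrow> (f La \<and> odd (count_list w La)) \<noteq>
      ((f Lb \<and> odd (count_list w Lb)) \<noteq> (f Lc \<and> odd (count_list w Lc)))" for f w
  have "\<exists>fa fb fc. (fa \<or> fb \<or> fc) \<and> \<not> ((fa \<and> p) \<noteq> ((fb \<and> q) \<noteq> (fc \<and> r))) \<and>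
    \<not> ((fa \<and> p') \<noteq> ((fb \<and> q') \<noteq> (fc \<and> r')))" for p q r p' q' r'
    unfolding ex_bool_eq by (cases p; cases q; cases r) auto
  from this[of "odd (count_list u La)" "odd (count_list u Lb)" "odd (count_list u Lc)"
      "odd (count_list v La)" "odd (count_list v Lb)" "odd (count_list v Lc)"]
  have "\<exists>fa fb fc. (fa \<or> fb \<or> fc) \<and> \<not> odd_in (case_letter fa fb fc) u \<and> \<not> odd_in (case_letter fa fb fc) v"
    unfolding odd_in_def letter.case .
  then obtain fa fb fc where f: "fa \<or> fb \<or> fc"
    and even: "\<not> odd_in (case_letter fa fb fc) u" "\<not> odd_in (case_letter fa fb fc) v"
    by blast
  define f where "f = case_letter fa fb fc"
  define \<rho> :: "letter \<Rightarrow> nat \<times> letter list \<Rightarrow> nat \<times> letter list" where "\<rho> x = (if f x then toggle else id)" for x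
  have bij: "bij (\<rho> x)" for x
    by (simp add: \<rho>_def bij_toggle)
  have odd_in_Cons: "odd_in f (x # w) \<longleftrightarrow> f x \<noteq> odd_in f w" for x w
    by (cases x) (auto simp: odd_in_def)
  have fold: "fold \<rho> w p = (if odd_in f w then toggle p else p)" for w p
    by (induction w arbitrary: p) (auto simp: \<rho>_def odd_in_Cons toggle_toggle, simp add: odd_in_def)
  have "\<rho> x (0, []) = (0, [])" for x
    using gen bij even[folded f_def] unfolding generating_def
    by (metis (no_types, lifting) fold insertE singletonD)
  moreover have "\<rho> x (0, []) \<noteq> (0, [])" if "f x" for x
    using that by (simp add: \<rho>_def toggle_def)
  ultimately have "\<not> f x" for x
    by blast
  from this[of La] this[of Lb] this[of Lc] show False
    using f by (simp add: f_def)
qed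

section \<open>Immersed graphs\<close>

lemma extend_partial_bijection:
  fixes R :: "'v rel"
  assumes fin: "finite R" and R: "single_valued R" "single_valued (R\<inverse>)"
  shows "\<exists>f. bij f \<and> (\<forall>(a, b)\<in>R. f a = b)"
proof -
  define A where "A = Domain R"
  define B where "B = Range R"
  define g where "g a = (THE b. (a, b) \<in> R)" for a
  have finA: "finite A" and finB: "finite B"
    using fin by (simp_all add: A_def B_def finite_Domain finite_Range)
  have g: "g a = b" if "(a, b) \<in> R" for a b
    unfolding g_def using that R(1) by (auto dest: single_valuedD)
  have "inj_on g A"
  proof (rule inj_onI)
    fix a a'
    assume "a \<in> A" "a' \<in> A" "g a = g a'"
    then obtain b b' where "(a, b) \<in> R" "(a', b') \<in> R"
      by (auto simp: A_def)
    with g[of a b] g[of a' b'] \<open>g a = g a'\<close> show "a = a'"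
      using R(2) by (auto dest: single_valuedD)
  qed
  moreover have "g ` A = B"
    unfolding A_def B_def using g by (force simp: image_iff)
  ultimately have gAB: "bij_betw g A B"
    by (simp add: bij_betw_def)
  then have card: "card A = card B"
    by (rule bij_betw_same_card)
  have "card (B - A) = card (A - B)"
    using card_Diff_subset_Int[of B A] card_Diff_subset_Int[of A B] finA finB card
    by (simp add: Int_commute)
  then obtain h where h: "bij_betw h (B - A) (A - B)"
    using finite_same_card_bij[of "B - A" "A - B"] finA finB by auto
  define f where "f x = (if x \<in> A then g x else if x \<in> B - A then h x else x)" for x
  have 1: "bij_betw f A B"
    using gAB by (subst bij_betw_cong[of A f g]) (auto simp: f_def)
  have 2: "bij_betw f (B - A) (A - B)"
    using h by (subst bij_betw_cong[of "B - A" f h]) (auto simp: f_def)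
  have 3: "bij_betw f (- (A \<union> B)) (- (A \<union> B))"
    by (subst bij_betw_cong[of _ f id]) (auto simp: f_def)
  have 4: "bij_betw f (A \<union> (B - A)) (B \<union> (A - B))"
    using bij_betw_combine[OF 1 2] by auto
  have "bij_betw f ((A \<union> (B - A)) \<union> - (A \<union> B)) ((B \<union> (A - B)) \<union> - (A \<union> B))"
    using bij_betw_combine[OF 4 3] by auto
  moreover have "(A \<union> (B - A)) \<union> - (A \<union> B) = UNIV" "(B \<union> (A - B)) \<union> - (A \<union> B) = UNIV"
    by auto
  ultimately have "bij f"
    by simp
  moreover have "\<forall>(a, b)\<in>R. f a = b"
    using g by (auto simp: f_def A_def)
  ultimately show ?thesis
    by blast
qed

type_synonym 'a arc = "nat \<times> 'a list \<times> nat"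

text \<open>
  An arc \<open>(a, w, b)\<close> stands for a path of edges that reads \<open>w\<close> from the vertex \<open>(a, [])\<close>
  to the vertex \<open>(b, [])\<close> through new inner vertices. The conditions say that the
  subdivided graph cannot be folded, i.e. immerses into the rose.
\<close>
definition immersed :: "'a arc set \<Rightarrow> bool" where
  "immersed E \<longleftrightarrow> finite E \<and> (\<forall>(a, w, b)\<in>E. w \<noteq> []) \<and>
     (\<forall>(a, w, b)\<in>E. \<forall>(a', w', b')\<in>E.
        (a = a' \<and> hd w = hd w' \<or> b = b' \<and> last w = last w') \<longrightarrow> (a, w, b) = (a', w', b'))"

lemma immersed_nonempty_arcsI:
  assumes "finite E"
    and "\<forall>(a, w, b)\<in>E. \<forall>(a', w', b')\<in>E. w \<noteq> [] \<and> w' \<noteq> [] \<longrightarrow>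
        (a = a' \<and> hd w = hd w' \<or> b = b' \<and> last w = last w') \<longrightarrow> (a, w, b) = (a', w', b')"
  shows "immersed {(a, w, b) \<in> E. w \<noteq> []}"
  unfolding immersed_def
proof (intro conjI)
  show "finite {(a, w, b) \<in> E. w \<noteq> []}"
    by (rule finite_subset[OF _ assms(1)]) auto
qed (use assms(2) in fast)+

definition edges :: "'a arc set \<Rightarrow> 'a \<Rightarrow> ((nat \<times> 'a list) \<times> (nat \<times> 'a list)) set" where
  "edges E x = {((a, w), if r = [] then (b, []) else (a, w @ [x])) | a w r b. (a, w @ x # r, b) \<in> E}"

text \<open>
  An inner vertex \<open>(a, w)\<close> with \<open>w\<close> nonempty determines its arc, since arcs that leave
  \<open>a\<close> differ in their first letters; this is why the arc need not be part of the vertex.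
\<close>
lemma edges_partial_bijection:
  assumes "immersed E"
  shows "finite (edges E x)" "single_valued (edges E x)" "single_valued ((edges E x)\<inverse>)"
proof -
  have E: "finite E"
    and all: "\<forall>(a, w, b)\<in>E. \<forall>(a', w', b')\<in>E.
        (a = a' \<and> hd w = hd w' \<or> b = b' \<and> last w = last w') \<longrightarrow> (a, w, b) = (a', w', b')"
    using assms by (simp_all add: immersed_def)
  have tl: "w = w' \<and> b = b'" if "(a, w, b) \<in> E" "(a, w', b') \<in> E" "hd w = hd w'" for a w b w' b'
    using bspec[OF all that(1)] that(2,3) by auto
  have tr: "w = w' \<and> a = a'" if "(a, w, b) \<in> E" "(a', w', b) \<in> E" "last w = last w'" for a w b w' a'
    using bspec[OF all that(1)] that(2,3) by auto
  define src where "src = (\<lambda>((a :: nat, w, b :: nat), n).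
    ((a, take n w), if drop (Suc n) w = [] then (b, []) else (a, take n w @ [x])))"
  have "edges E x \<subseteq> src ` (SIGMA (a, w, b) : E. {..length w})"
  proof
    fix p
    assume "p \<in> edges E x"
    then obtain a w r b where p: "p = ((a, w), if r = [] then (b, []) else (a, w @ [x]))"
      and "(a, w @ x # r, b) \<in> E"
      unfolding edges_def by blast
    then show "p \<in> src ` (SIGMA (a, w, b) : E. {..length w})"
      by (intro image_eqI[of _ _ "((a, w @ x # r, b), length w)"]) (auto simp: src_def)
  qed
  moreover have "finite (src ` (SIGMA (a, w, b) : E. {..length w}))"
    using E by (intro finite_imageI finite_SigmaI) auto
  ultimately show "finite (edges E x)"
    by (rule finite_subset)
  show "single_valued (edges E x)"
  proof (rule single_valuedI)
    fix p q q'
    assume "(p, q) \<in> edges E x" "(p, q') \<in> edges E x"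
    then obtain a w r b r' b' where *: "p = (a, w)" "(a, w @ x # r, b) \<in> E" "(a, w @ x # r', b') \<in> E"
      "q = (if r = [] then (b, []) else (a, w @ [x]))" "q' = (if r' = [] then (b', []) else (a, w @ [x]))"
      unfolding edges_def by auto
    have "hd (w @ x # r) = hd (w @ x # r')" by (cases w) auto
    from tl[OF *(2,3) this] show "q = q'" using * by auto
  qed
  show "single_valued ((edges E x)\<inverse>)"
  proof (rule single_valuedI)
    fix p p' q
    assume "(q, p) \<in> (edges E x)\<inverse>" "(q, p') \<in> (edges E x)\<inverse>"
    then obtain a w r b a' w' r' b' where *: "p = (a, w)" "p' = (a', w')"
      "(a, w @ x # r, b) \<in> E" "(a', w' @ x # r', b') \<in> E"
      "q = (if r = [] then (b, []) else (a, w @ [x]))" "q = (if r' = [] then (b', []) else (a', w' @ [x]))"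
      unfolding edges_def by auto
    show "p = p'"
    proof (cases "r = []")
      case True
      then have "r' = []" "b = b'" using *(5,6) by (auto split: if_splits)
      then show ?thesis using tr[of a "w @ [x]" b a' "w' @ [x]"] * True by auto
    next
      case False
      then show ?thesis using * by (auto split: if_splits)
    qed
  qed
qed

lemma immersed_action:
  fixes E :: "'a arc set"
  assumes "immersed E"
  obtains \<rho> :: "'a \<Rightarrow> nat \<times> 'a list \<Rightarrow> nat \<times> 'a list"
  where "\<And>x. bij (\<rho> x)" "\<And>a w b. (a, w, b) \<in> E \<Longrightarrow> fold \<rho> w (a, []) = (b, [])"
    "\<And>a x r b. (a, x # r, b) \<in> E \<Longrightarrow> \<rho> x (a, []) = (if r = [] then (b, []) else (a, [x]))"
proof -
  have "\<forall>x. \<exists>f. bij f \<and> (\<forall>(p, q)\<in>edges E x. f p = q)"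
    using extend_partial_bijection edges_partial_bijection[OF assms] by blast
  then obtain \<rho> where \<rho>: "\<forall>x. bij (\<rho> x) \<and> (\<forall>(p, q)\<in>edges E x. \<rho> x p = q)"
    by (rule choice[THEN exE])
  have bij: "\<And>x. bij (\<rho> x)" and edge: "\<And>x p q. (p, q) \<in> edges E x \<Longrightarrow> \<rho> x p = q"
    using \<rho> by auto
  have step: "\<rho> x (a, w) = (if r = [] then (b, []) else (a, w @ [x]))"
    if "(a, w @ x # r, b) \<in> E" for a w x r b
    using that by (intro edge) (auto simp: edges_def)
  have run: "fold \<rho> w (a, []) = (a, w)" if "(a, w @ r, b) \<in> E" "r \<noteq> []" for a w r b
    using that
  proof (induction w arbitrary: r rule: rev_induct)
    case (snoc x w)
    then show ?case using step[of a w x r b] snoc.IH[of "x # r"] by simp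
  qed simp
  have "fold \<rho> w (a, []) = (b, [])" if "(a, w, b) \<in> E" for a w b
  proof (cases w rule: rev_cases)
    case Nil
    then show ?thesis using that assms by (auto simp: immersed_def)
  next
    case (snoc w' x)
    then show ?thesis using run[of a w' "[x]" b] step[of a w' x "[]" b] that by simp
  qed
  moreover have "\<rho> x (a, []) = (if r = [] then (b, []) else (a, [x]))" if "(a, x # r, b) \<in> E" for a x r b
    using step[of a "[]" x r b] that by simp
  ultimately show thesis
    using that[of \<rho>] bij by simp
qed

text \<open>
  The first letter of an arc that leaves \<open>c\<close> moves \<open>(c, [])\<close> unless the arc is a loop of
  length one. Empty arcs are admitted as trivial loops, so that a graph can be given uniformly
  when some of its labels may be empty.
\<close>
lemma generating_immersed:
  fixes E :: "'a arc set"
  assumes imm: "immersed {(a, w, b) \<in> E. w \<noteq> []}" and triv: "\<And>a b. (a, [], b) \<in> E \<Longrightarrow> a = b"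
    and gen: "generating W"
    and loops: "\<And>(\<rho> :: 'a \<Rightarrow> nat \<times> 'a list \<Rightarrow> nat \<times> 'a list) w.
      (\<And>a w b. (a, w, b) \<in> E \<Longrightarrow> fold \<rho> w (a, []) = (b, [])) \<Longrightarrow> w \<in> W \<Longrightarrow> fold \<rho> w (c, []) = (c, [])"
    and arc: "(c, w, b) \<in> E" "w \<noteq> []"
  shows "length w = 1 \<and> b = c"
proof -
  obtain \<rho> where \<rho>: "\<And>x. bij (\<rho> x)"
    "\<And>a w b. (a, w, b) \<in> {(a, w, b) \<in> E. w \<noteq> []} \<Longrightarrow> fold \<rho> w (a, []) = (b, [])"
    "\<And>a x r b. (a, x # r, b) \<in> {(a, w, b) \<in> E. w \<noteq> []} \<Longrightarrow>
       \<rho> x (a, []) = (if r = [] then (b, []) else (a, [x]))"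
    using immersed_action[OF imm] by blast
  have run: "fold \<rho> w (a, []) = (b, [])" if "(a, w, b) \<in> E" for a w b
    using \<rho>(2)[of a w b] triv[of a b] that by (cases "w = []") auto
  obtain x r where w: "w = x # r"
    using arc(2) by (cases w) auto
  have "\<rho> x (c, []) = (c, [])"
    using gen loops[OF run] \<rho>(1) unfolding generating_def by blast
  then show ?thesis
    using \<rho>(3)[of c x r b] arc(1) w by (auto split: if_splits)
qed

section \<open>The four folded graphs\<close>

lemma fold_replicate_fixed: "fold \<rho> g v = v \<Longrightarrow> fold \<rho> (concat (replicate k g)) v = v"
  by (induction k) simp_all

text \<open>
  The Lyndon--Schuetzenberger description of the solutions of \<open>r g = g' r\<close>: \<open>r\<close> reads
  around the loop \<open>g'\<close> some number of times and stops after \<open>r'\<close>.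
\<close>
lemma conjugate_words:
  assumes "r @ g = g' @ r" "g \<noteq> []"
  shows "\<exists>k r' r''. r'' \<noteq> [] \<and> g' = r' @ r'' \<and> g = r'' @ r' \<and> r = concat (replicate k g') @ r'"
  using assms(1)
proof (induction "length r" arbitrary: r rule: less_induct)
  case less
  have len: "length g' = length g"
    using arg_cong[OF less.prems, of length] by simp
  show ?case
  proof (cases "length r < length g'")
    case True
    then obtain r'' where r'': "g' = r @ r''"
      using less.prems by (auto simp: append_eq_append_conv2)
    then have "g = r'' @ r"
      using less.prems by simp
    then show ?thesis
      using r'' True by (intro exI[of _ 0] exI[of _ r] exI[of _ r'']) auto
  next
    case False
    then obtain s where s: "r = g' @ s"
      using less.prems by (auto simp: append_eq_append_conv2)
    then have "s @ g = g' @ s" "length s < length r"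
      using less.prems len assms(2) by auto
    from less.hyps[OF this(2,1)] obtain k r' r''
      where "r'' \<noteq> []" "g' = r' @ r''" "g = r'' @ r'" "s = concat (replicate k g') @ r'"
      by blast
    then show ?thesis
      using s by (intro exI[of _ "Suc k"] exI[of _ r'] exI[of _ r'']) auto
  qed
qed

text \<open>
  In all four graphs the vertex \<open>0\<close> is the end of \<open>s\<close> and \<open>Y\<close>, its start, is the base
  point; they coincide if \<open>s\<close> is empty, and likewise for the ends of \<open>p\<close>, \<open>t\<close> and
  \<open>d\<close>. A nonempty \<open>s\<close> thus already yields an arc that leaves the base point and is not a
  loop. In the first graph \<open>p\<close> is shared by the first two words and \<open>t\<close> by the first and
  the third one, without overlap.
\<close>
lemma generating_fork_chain:
  assumes gen: "generating {s @ p @ m @ t, s @ p @ v, s @ w @ t}"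
    and ne: "m \<noteq> []" "v \<noteq> []" "w \<noteq> []"
    and ends: "hd m \<noteq> hd v" "hd w \<noteq> hd (p @ m)" "hd w \<noteq> hd (p @ v)"
      "last m \<noteq> last w" "last v \<noteq> last (m @ t)" "last v \<noteq> last (w @ t)"
  shows "s = [] \<and> length m = 1 \<and> length v = 1 \<and> length w = 1 \<and> p = [] \<and> t = []"
proof -
  define X where "X = (if p = [] then 0 else 1 :: nat)"
  define Y where "Y = (if s = [] then 0 else 2 :: nat)"
  define Z where "Z = (if t = [] then Y else 3)"
  define E where "E = {(0, p, X), (X, m, Z), (Z, t, Y), (X, v, Y), (0, w, Z), (Y, s, 0)}"
  have imm: "immersed {(a, l, b) \<in> E. l \<noteq> []}"
    unfolding E_def X_def Y_def Z_def
    using ne ends by (intro immersed_nonempty_arcsI; (cases "p = []"; cases "s = []"; cases "t = []")) simp_all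
  have triv: "a = b" if "(a, [], b) \<in> E" for a b
    using that ne by (auto simp: E_def X_def Y_def Z_def split: if_splits)
  have arc: "length l = 1 \<and> b = Y" if "(Y, l, b) \<in> E" "l \<noteq> []" for l b
  proof (rule generating_immersed[OF imm triv gen _ that], goal_cases)
    case (2 \<rho> x)
    note run = 2(1)[unfolded E_def]
    have "fold \<rho> s (Y, []) = (0, [])" "fold \<rho> p (0, []) = (X, [])" "fold \<rho> m (X, []) = (Z, [])"
      "fold \<rho> t (Z, []) = (Y, [])" "fold \<rho> v (X, []) = (Y, [])" "fold \<rho> w (0, []) = (Z, [])"
      by (rule run; simp)+
    then show ?case
      using 2(2) by auto
  qed
  have "s = []"
    using arc[of s 0] by (auto simp: E_def Y_def)
  then have Y: "Y = 0"
    by (simp add: Y_def)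
  have "p = []"
    using arc[of p X] Y by (auto simp: E_def X_def)
  then have X: "X = 0"
    by (simp add: X_def)
  have "length m = 1 \<and> Z = 0" "length v = 1" "length w = 1"
    using arc[of m Z] arc[of v Y] arc[of w Z] ne by (auto simp: E_def X Y)
  then show ?thesis
    using \<open>s = []\<close> \<open>p = []\<close> by (auto simp: Z_def split: if_splits)
qed

text \<open>
  The shared prefix \<open>u' d\<close> and the shared suffix \<open>d u\<close> of the first word overlap in
  \<open>d\<close>, so that all three words run through the arc \<open>d\<close>. The contradiction is that the arc \<open>u'\<close>
  leads away from the vertex \<open>0\<close>, which is the base point when \<open>s\<close> is empty.
\<close>
lemma not_generating_overlap:
  assumes gen: "generating {s @ u' @ d @ u, s @ u' @ d @ v, s @ w @ d @ u}"
    and ne: "u' \<noteq> []" "u \<noteq> []" "v \<noteq> []" "w \<noteq> []"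
    and ends: "hd u \<noteq> hd v" "hd w \<noteq> hd u'" "last u' \<noteq> last w" "last u \<noteq> last v"
  shows False
proof -
  define X where "X = (if d = [] then 1 else 3 :: nat)"
  define Y where "Y = (if s = [] then 0 else 2 :: nat)"
  define E where "E = {(0, u', 1), (1, d, X), (X, u, Y), (X, v, Y), (0, w, 1), (Y, s, 0)}"
  have imm: "immersed {(a, l, b) \<in> E. l \<noteq> []}"
    unfolding E_def X_def Y_def
    using ne ends by (intro immersed_nonempty_arcsI; (cases "d = []"; cases "s = []")) simp_all
  have triv: "a = b" if "(a, [], b) \<in> E" for a b
    using that ne by (auto simp: E_def X_def Y_def split: if_splits)
  have arc: "length l = 1 \<and> b = Y" if "(Y, l, b) \<in> E" "l \<noteq> []" for l b
  proof (rule generating_immersed[OF imm triv gen _ that], goal_cases)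
    case (2 \<rho> x)
    note run = 2(1)[unfolded E_def]
    have "fold \<rho> s (Y, []) = (0, [])" "fold \<rho> u' (0, []) = (1, [])" "fold \<rho> d (1, []) = (X, [])"
      "fold \<rho> u (X, []) = (Y, [])" "fold \<rho> v (X, []) = (Y, [])" "fold \<rho> w (0, []) = (1, [])"
      by (rule run; simp)+
    then show ?case
      using 2(2) by auto
  qed
  have "s = []"
    using arc[of s 0] by (auto simp: E_def Y_def)
  then have "Y = 0"
    by (simp add: Y_def)
  then show False
    using arc[of u' 1] ne by (auto simp: E_def)
qed

text \<open>
  Here the same two words share both \<open>p\<close> and \<open>t\<close>, without overlap in either word.
\<close>
lemma generating_parallel_chains:
  assumes gen: "generating {s @ p @ m @ t, s @ p @ n @ t, s @ w}"
    and ne: "m \<noteq> []" "n \<noteq> []" "w \<noteq> []"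
    and ends: "hd m \<noteq> hd n" "hd w \<noteq> hd (p @ m)" "hd w \<noteq> hd (p @ n)"
      "last m \<noteq> last n" "last w \<noteq> last (m @ t)" "last w \<noteq> last (n @ t)"
  shows "s = [] \<and> length m = 1 \<and> length n = 1 \<and> length w = 1 \<and> p = [] \<and> t = []"
proof -
  define X where "X = (if p = [] then 0 else 1 :: nat)"
  define Y where "Y = (if s = [] then 0 else 2 :: nat)"
  define Z where "Z = (if t = [] then Y else 3)"
  define E where "E = {(0, p, X), (X, m, Z), (X, n, Z), (Z, t, Y), (0, w, Y), (Y, s, 0)}"
  have imm: "immersed {(a, l, b) \<in> E. l \<noteq> []}"
    unfolding E_def X_def Y_def Z_def
    using ne ends by (intro immersed_nonempty_arcsI; (cases "p = []"; cases "s = []"; cases "t = []")) simp_all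
  have triv: "a = b" if "(a, [], b) \<in> E" for a b
    using that ne by (auto simp: E_def X_def Y_def Z_def split: if_splits)
  have arc: "length l = 1 \<and> b = Y" if "(Y, l, b) \<in> E" "l \<noteq> []" for l b
  proof (rule generating_immersed[OF imm triv gen _ that], goal_cases)
    case (2 \<rho> x)
    note run = 2(1)[unfolded E_def]
    have "fold \<rho> s (Y, []) = (0, [])" "fold \<rho> p (0, []) = (X, [])" "fold \<rho> m (X, []) = (Z, [])"
      "fold \<rho> t (Z, []) = (Y, [])" "fold \<rho> n (X, []) = (Z, [])" "fold \<rho> w (0, []) = (Y, [])"
      by (rule run; simp)+
    then show ?case
      using 2(2) by auto
  qed
  have "s = []"
    using arc[of s 0] by (auto simp: E_def Y_def)
  then have Y: "Y = 0"
    by (simp add: Y_def)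
  have "p = []"
    using arc[of p X] Y by (auto simp: E_def X_def)
  then have X: "X = 0"
    by (simp add: X_def)
  have "length m = 1 \<and> Z = 0" "length n = 1" "length w = 1"
    using arc[of m Z] arc[of n Z] arc[of w Y] ne by (auto simp: E_def X Y)
  then show ?thesis
    using \<open>s = []\<close> \<open>p = []\<close> by (auto simp: Z_def split: if_splits)
qed

text \<open>
  If two words share both a prefix and a suffix and these overlap in the shorter word, then folding
  closes a loop: the longer word runs around \<open>d d'\<close> once more than the shorter one.
\<close>
lemma not_generating_loop:
  assumes gen: "generating {s @ e @ concat (replicate k (d @ d')) @ d @ u,
      s @ e @ concat (replicate (Suc k) (d @ d')) @ d @ u, s @ w}"
    and ne: "e \<noteq> []" "d' \<noteq> []" "u \<noteq> []" "w \<noteq> []"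
    and ends: "hd d' \<noteq> hd u" "last d' \<noteq> last e" "hd e \<noteq> hd w" "last u \<noteq> last w"
  shows False
proof -
  define X where "X = (if d = [] then 1 else 3 :: nat)"
  define Y where "Y = (if s = [] then 0 else 2 :: nat)"
  define E where "E = {(0, e, 1), (1, d, X), (X, d', 1), (X, u, Y), (0, w, Y), (Y, s, 0)}"
  have imm: "immersed {(a, l, b) \<in> E. l \<noteq> []}"
    unfolding E_def X_def Y_def
    using ne ends by (intro immersed_nonempty_arcsI; (cases "d = []"; cases "s = []")) simp_all
  have triv: "a = b" if "(a, [], b) \<in> E" for a b
    using that ne by (auto simp: E_def X_def Y_def split: if_splits)
  have arc: "length l = 1 \<and> b = Y" if "(Y, l, b) \<in> E" "l \<noteq> []" for l b
  proof (rule generating_immersed[OF imm triv gen _ that], goal_cases)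
    case (2 \<rho> x)
    note run = 2(1)[unfolded E_def]
    have *: "fold \<rho> s (Y, []) = (0, [])" "fold \<rho> e (0, []) = (1, [])" "fold \<rho> d (1, []) = (X, [])"
      "fold \<rho> d' (X, []) = (1, [])" "fold \<rho> u (X, []) = (Y, [])" "fold \<rho> w (0, []) = (Y, [])"
      by (rule run; simp)+
    have "fold \<rho> (concat (replicate k (d @ d'))) (1, []) = (1, [])"
      by (rule fold_replicate_fixed) (simp add: * del: One_nat_def)
    then show ?case
      using 2(2) * by (auto simp del: One_nat_def)
  qed
  have "s = []"
    using arc[of s 0] by (auto simp: E_def Y_def)
  then have "Y = 0"
    by (simp add: Y_def)
  then show False
    using arc[of e 1] ne by (auto simp: E_def)
qed

section \<open>Generating bifix codes\<close>

lemma append_eq_append_longer_right: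
  assumes "a @ b = c @ d" "length b \<le> length d"
  obtains g where "d = g @ b" "a = c @ g"
  using assms that by (auto simp: append_eq_append_conv2)

lemma append_eq_append_overlap:
  assumes "p @ u = u' @ t"
  obtains m where "m \<noteq> []" "u' = p @ m" "u = m @ t" | d where "p = u' @ d" "t = d @ u"
proof (cases "length p < length u'")
  case True
  then have "length t \<le> length u"
    using arg_cong[OF assms, of length] by simp
  from append_eq_append_longer_right[OF assms[symmetric] this] obtain m where "u' = p @ m" "u = m @ t"
    by metis
  with True show ?thesis using that(1) by auto
next
  case False
  then have "length u \<le> length t"
    using arg_cong[OF assms, of length] by simp
  from append_eq_append_longer_right[OF assms this] show ?thesis
    using that(2) by metis
qed

lemma parallel_last_decomp:
  assumes "\<not> suffix u v" "\<not> suffix v u"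
  obtains t u' v' where "u = u' @ t" "v = v' @ t" "u' \<noteq> []" "v' \<noteq> []" "last u' \<noteq> last v'"
proof -
  have "rev u \<parallel> rev v"
    using assms by (simp add: suffix_to_prefix parallel_def)
  from parallel_decomp[OF this] obtain t b bs c cs
    where "b \<noteq> c" "rev u = t @ b # bs" "rev v = t @ c # cs"
    by blast
  then have "u = (rev bs @ [b]) @ rev t" "v = (rev cs @ [c]) @ rev t" "b \<noteq> c"
    by (simp_all add: rev_swap)
  then show thesis
    by (intro that[of "rev bs @ [b]" "rev t" "rev cs @ [c]"]) auto
qed

lemma parallel_hd_decomp:
  assumes "\<not> prefix u v" "\<not> prefix v u"
  obtains p u' v' where "u = p @ u'" "v = p @ v'" "u' \<noteq> []" "v' \<noteq> []" "hd u' \<noteq> hd v'"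
  using parallel_decomp[of u v] assms that by (auto simp: parallel_def)

text \<open>
  The prefix odd one out, \<open>w\<close>, differs from the suffix odd one out, \<open>v\<close>. So \<open>u\<close>
  shares a prefix with \<open>v\<close> and a suffix with \<open>w\<close>, and only their overlap within \<open>u\<close> matters.
\<close>
lemma generating_crossed_pairs:
  assumes gen: "generating {s @ u, s @ v, s @ w}"
    and code: "\<not> prefix u v" "\<not> prefix v u" "\<not> suffix u w" "\<not> suffix w u"
    and odd: "hd w \<noteq> hd u" "hd w \<noteq> hd v" "last v \<noteq> last u" "last v \<noteq> last w"
  shows "s = [] \<and> length u = 1 \<and> length v = 1 \<and> length w = 1"
proof -
  obtain p u1 v1 where p: "u = p @ u1" "v = p @ v1" "u1 \<noteq> []" "v1 \<noteq> []" "hd u1 \<noteq> hd v1"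
    using parallel_hd_decomp[OF code(1,2)] by blast
  obtain t u2 w2 where t: "u = u2 @ t" "w = w2 @ t" "u2 \<noteq> []" "w2 \<noteq> []" "last u2 \<noteq> last w2"
    using parallel_last_decomp[OF code(3,4)] by blast
  consider m where "m \<noteq> []" "u2 = p @ m" "u1 = m @ t" | d where "p = u2 @ d" "t = d @ u1"
    using append_eq_append_overlap[of p u1 u2 t] p(1) t(1) by metis
  then show ?thesis
  proof cases
    case 1
    have "s = [] \<and> length m = 1 \<and> length v1 = 1 \<and> length w2 = 1 \<and> p = [] \<and> t = []"
    proof (intro generating_fork_chain)
      have "hd (p @ m) = hd u" "hd w2 = hd w"
        using p t 1 by (cases p; simp)+
      then show "hd w2 \<noteq> hd (p @ m)" "hd w2 \<noteq> hd (p @ v1)"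
        using odd p by simp_all
    qed (use gen p t odd 1 in auto)
    then show ?thesis
      using p t 1 by simp
  next
    case 2
    have False
    proof (rule not_generating_overlap[of s u2 d u1 v1 w2])
      show "generating {s @ u2 @ d @ u1, s @ u2 @ d @ v1, s @ w2 @ d @ u1}"
        using gen p t(1,2) 2 by simp
    qed (use p t odd 2 in auto)
    then show ?thesis ..
  qed
qed

text \<open>
  The word \<open>w\<close> is the odd one out at both ends. If the common prefix \<open>p\<close> and the common suffix
  \<open>t\<close> of \<open>u\<close> and \<open>v\<close> overlap in \<open>u\<close>, with overlap \<open>d\<close>, then
  \<open>d\<close> satisfies an equation \<open>d g = g' d\<close>, which makes it a path around a loop \<open>g'\<close>.
\<close>
lemma generating_same_pair:
  assumes gen: "generating {s @ u, s @ v, s @ w}"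
    and code: "\<not> prefix u v" "\<not> prefix v u" "\<not> suffix u v" "\<not> suffix v u"
    and odd: "hd w \<noteq> hd u" "hd w \<noteq> hd v" "last w \<noteq> last u" "last w \<noteq> last v"
    and w: "w \<noteq> []" and le: "length u \<le> length v"
  shows "s = [] \<and> length u = 1 \<and> length v = 1 \<and> length w = 1"
proof -
  obtain p u1 v1 where p: "u = p @ u1" "v = p @ v1" "u1 \<noteq> []" "v1 \<noteq> []" "hd u1 \<noteq> hd v1"
    using parallel_hd_decomp[OF code(1,2)] by blast
  obtain t u2 v2 where t: "u = u2 @ t" "v = v2 @ t" "u2 \<noteq> []" "v2 \<noteq> []" "last u2 \<noteq> last v2"
    using parallel_last_decomp[OF code(3,4)] by blast
  consider m where "m \<noteq> []" "u2 = p @ m" "u1 = m @ t" | d where "p = u2 @ d" "t = d @ u1"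
    using append_eq_append_overlap[of p u1 u2 t] p(1) t(1) by metis
  then show ?thesis
  proof cases
    case 1
    have "length t < length v1"
      using le 1 unfolding p(1,2) by (cases m) auto
    moreover obtain n where "v2 = p @ n" "v1 = n @ t"
    proof (rule append_eq_append_longer_right)
      show "v2 @ t = p @ v1" "length t \<le> length v1"
        using p(2) t(2) calculation by auto
    qed
    ultimately have n: "n \<noteq> []" "v2 = p @ n" "v1 = n @ t"
      by auto
    have "s = [] \<and> length m = 1 \<and> length n = 1 \<and> length w = 1 \<and> p = [] \<and> t = []"
    proof (intro generating_parallel_chains)
      show "generating {s @ p @ m @ t, s @ p @ n @ t, s @ w}"
        using gen p(1,2) 1 n by simp
      have "hd (p @ m) = hd u" "hd (p @ n) = hd v"
        using p(1,2) 1 n by (cases p; simp)+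
      then show "hd w \<noteq> hd (p @ m)" "hd w \<noteq> hd (p @ n)"
        using odd by simp_all
    qed (use p t odd 1 n w in auto)
    then show ?thesis
      using p t 1 n by simp
  next
    case 2
    have "length u1 \<le> length v1"
      using le p by simp
    moreover have "(v2 @ d) @ u1 = (u2 @ d) @ v1"
      using p(2) t(2) 2 by simp
    ultimately obtain g where g: "v1 = g @ u1" "v2 @ d = u2 @ d @ g"
      by (metis append_eq_append_longer_right append_assoc)
    then have "g \<noteq> []"
      using p(5) by auto
    (* g is the loop as read from the end of p, g' the same loop as read from the end of u2. *)
    obtain g' where g': "v2 = u2 @ g'" "d @ g = g' @ d"
      by (rule append_eq_append_longer_right[OF g(2)]) auto
    obtain k r' r'' where r: "r'' \<noteq> []" "g' = r' @ r''" "g = r'' @ r'" "d = concat (replicate k g') @ r'"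
      using conjugate_words[OF g'(2) \<open>g \<noteq> []\<close>] by blast
    have u: "u = u2 @ concat (replicate k (r' @ r'')) @ r' @ u1"
      unfolding p(1) 2(1) r(4) by (simp add: r(2))
    have v: "v = u2 @ concat (replicate (Suc k) (r' @ r'')) @ r' @ u1"
      unfolding t(2) 2(2) g'(1) r(4) by (simp add: r(2))
    have ends: "hd v1 = hd r''" "last v2 = last r''"
      unfolding g(1) r(3) g'(1) r(2) using r(1) by simp_all
    have False
    proof (rule not_generating_loop)
      show "generating {s @ u2 @ concat (replicate k (r' @ r'')) @ r' @ u1,
        s @ u2 @ concat (replicate (Suc k) (r' @ r'')) @ r' @ u1, s @ w}"
        using gen unfolding u v .
      show "u2 \<noteq> []" "r'' \<noteq> []" "u1 \<noteq> []" "w \<noteq> []"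
        using p(3) t(3) r(1) w by auto
      show "hd r'' \<noteq> hd u1" "last r'' \<noteq> last u2"
        using p(5) t(5) ends by auto
      have "hd u2 = hd u"
        using t(1,3) by simp
      moreover have "last u1 = last u"
        using p(1,3) by simp
      ultimately show "hd u2 \<noteq> hd w" "last u1 \<noteq> last w"
        using odd(1,3) by auto
    qed
    then show ?thesis ..
  qed
qed

text \<open>Prefix codes of three words; suffix codes are obtained by reversing the words.\<close>
definition code3 :: "'a list \<Rightarrow> 'a list \<Rightarrow> 'a list \<Rightarrow> bool" where
  "code3 u v w \<longleftrightarrow> \<not> prefix u v \<and> \<not> prefix v u \<and> \<not> prefix u w \<and> \<not> prefix w u \<and> \<not> prefix v w \<and> \<not> prefix w v"

text \<open>
  At each end, some word differs from both others in its outermost letter. Up to a permutation of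
  the words \<open>w\<close> is such a word at the left end; it remains to ask which word it is at the right end.
\<close>
lemma generating_bifix_code:
  assumes gen: "generating {s @ u, s @ v, s @ w}"
    and p: "code3 u v w" and s: "code3 (rev u) (rev v) (rev w)"
    and hd: "\<not> (hd u = hd v \<and> hd v = hd w)" and last: "\<not> (last u = last v \<and> last v = last w)"
  shows "s = [] \<and> length u = 1 \<and> length v = 1 \<and> length w = 1"
proof -
  have main: "s = [] \<and> length u = 1 \<and> length v = 1 \<and> length w = 1"
    if gen: "generating {s @ u, s @ v, s @ w}"
      and p: "code3 u v w" and s: "code3 (rev u) (rev v) (rev w)"
      and hd: "hd w \<noteq> hd u" "hd w \<noteq> hd v" and last: "\<not> (last u = last v \<and> last v = last w)"
    for u v w
  proof -
    have code: "\<not> prefix u v" "\<not> prefix v u" "\<not> suffix u w" "\<not> suffix w u"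
      "\<not> suffix v w" "\<not> suffix w v" "\<not> suffix u v" "\<not> suffix v u" "w \<noteq> []"
      using p s by (auto simp: code3_def suffix_to_prefix)
    have gen': "generating {s @ v, s @ u, s @ w}"
      using gen by (simp add: insert_commute)
    consider "last v \<noteq> last u" "last v \<noteq> last w" | "last u \<noteq> last v" "last u \<noteq> last w"
      | "last w \<noteq> last u" "last w \<noteq> last v"
      using last by argo
    then show ?thesis
    proof cases
      case 1
      then show ?thesis
        by (intro generating_crossed_pairs[OF gen] code hd)
    next
      case 2
      then have "s = [] \<and> length v = 1 \<and> length u = 1 \<and> length w = 1"
        by (intro generating_crossed_pairs[OF gen'] code hd)
      then show ?thesis by simp
    next
      case 3
      show ?thesis
      proof (cases "length u \<le> length v")
        case True
        show ?thesis
          by (intro generating_same_pair[OF gen] code hd 3 True)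
      next
        case False
        then have "length v \<le> length u" by simp
        then have "s = [] \<and> length v = 1 \<and> length u = 1 \<and> length w = 1"
          by (intro generating_same_pair[OF gen'] code hd 3)
        then show ?thesis by simp
      qed
    qed
  qed
  consider "hd w \<noteq> hd u" "hd w \<noteq> hd v" | "hd v \<noteq> hd u" "hd v \<noteq> hd w" | "hd u \<noteq> hd v" "hd u \<noteq> hd w"
    using hd by argo
  then show ?thesis
  proof cases
    case 1
    then show ?thesis using main[of u v w] assms by simp
  next
    case 2
    have "s = [] \<and> length u = 1 \<and> length w = 1 \<and> length v = 1"
    proof (rule main)
      show "generating {s @ u, s @ w, s @ v}" using gen by (simp add: insert_commute)
    qed (use p s 2 last in \<open>auto simp: code3_def\<close>)
    then show ?thesis by simp
  next
    case 3
    have "s = [] \<and> length v = 1 \<and> length w = 1 \<and> length u = 1"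
    proof (rule main)
      show "generating {s @ v, s @ w, s @ u}" using gen by (simp add: insert_commute)
    qed (use p s 3 last in \<open>auto simp: code3_def\<close>)
    then show ?thesis by simp
  qed
qed

section \<open>Elementary substitutions\<close>

definition subst :: "('a \<Rightarrow> 'b list) \<Rightarrow> 'a list \<Rightarrow> 'b list" where
  "subst h w = concat (map h w)"

lemma subst_simps [simp]:
  "subst h [] = []" "subst h (x # w) = h x @ subst h w" "subst h (u @ v) = subst h u @ subst h v"
  by (simp_all add: subst_def)

lemma subst_comp: "subst h \<circ> subst g = subst (\<lambda>x. subst h (g x))"
proof
  show "(subst h \<circ> subst g) w = subst (\<lambda>x. subst h (g x)) w" for w
    by (induction w) simp_all
qed

lemma triple_eq_subst: "triple u v w = subst (case_letter u v w)"
  by (simp add: fun_eq_iff triple_def subst_def)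

definition simple_map :: "(letter \<Rightarrow> letter list) \<Rightarrow> bool" where
  "simple_map h \<longleftrightarrow> subst h \<in> simple_substitutions"

lemma simple_map_comp: "simple_map h \<Longrightarrow> simple_map g \<Longrightarrow> simple_map (\<lambda>x. subst h (g x))"
  using simple_comp by (force simp: simple_map_def subst_comp[symmetric])

lemma simple_map_generators:
  "simple_map (case_letter [Lb] [La] [Lc])" "simple_map (case_letter [Lc] [Lb] [La])"
  "simple_map (case_letter [Lb, La] [Lb] [Lc])"
  using simple_pi1 simple_pi2 simple_phil by (simp_all add: simple_map_def triple_eq_subst)

lemma simple_map_permutation:
  assumes "inj \<pi>"
  shows "simple_map (\<lambda>x. [\<pi> x])"
proof -
  let ?s = "case_letter [Lb] [La] [Lc]" and ?t = "case_letter [Lc] [Lb] [La]"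
  have eqI: "simple_map (\<lambda>x. [\<pi> x])"
    if "simple_map g" "g La = [\<pi> La]" "g Lb = [\<pi> Lb]" "g Lc = [\<pi> Lc]" for g
  proof -
    have "g = (\<lambda>x. [\<pi> x])"
    proof
      show "g x = [\<pi> x]" for x
        using that by (cases x) auto
    qed
    then show ?thesis using that(1) by simp
  qed
  note st = simple_map_generators(1,2)
  have "\<pi> La \<noteq> \<pi> Lb" "\<pi> La \<noteq> \<pi> Lc" "\<pi> Lb \<noteq> \<pi> Lc"
    using assms by (auto dest: injD)
  then consider "\<pi> La = La" "\<pi> Lb = Lb" "\<pi> Lc = Lc" | "\<pi> La = Lb" "\<pi> Lb = La" "\<pi> Lc = Lc"
    | "\<pi> La = Lc" "\<pi> Lb = Lb" "\<pi> Lc = La" | "\<pi> La = Lc" "\<pi> Lb = La" "\<pi> Lc = Lb"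
    | "\<pi> La = Lb" "\<pi> Lb = Lc" "\<pi> Lc = La" | "\<pi> La = La" "\<pi> Lb = Lc" "\<pi> Lc = Lb"
    by (cases "\<pi> La"; cases "\<pi> Lb"; cases "\<pi> Lc") simp_all
  then show ?thesis
  proof cases
    case 1
    then show ?thesis by (intro eqI[OF simple_map_comp[OF st(1) st(1)]]) simp_all
  next
    case 2
    then show ?thesis by (intro eqI[OF st(1)]) simp_all
  next
    case 3
    then show ?thesis by (intro eqI[OF st(2)]) simp_all
  next
    case 4
    then show ?thesis by (intro eqI[OF simple_map_comp[OF st(1) st(2)]]) simp_all
  next
    case 5
    then show ?thesis by (intro eqI[OF simple_map_comp[OF st(2) st(1)]]) simp_all
  next
    case 6
    then show ?thesis
      by (intro eqI[OF simple_map_comp[OF st(1) simple_map_comp[OF st(2) st(1)]]]) simp_all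
  qed
qed

lemma other_letter:
  fixes i j :: letter
  assumes "i \<noteq> j"
  obtains k where "k \<noteq> i" "k \<noteq> j" "UNIV = {i, j, k}"
  using assms that[of La] that[of Lb] that[of Lc] by (cases i; cases j) (auto simp: letter_UNIV)

definition mult_left :: "letter \<Rightarrow> letter \<Rightarrow> letter \<Rightarrow> letter list" where
  "mult_left i j x = (if x = j then [i, j] else [x])"

definition mult_right :: "letter \<Rightarrow> letter \<Rightarrow> letter \<Rightarrow> letter list" where
  "mult_right i j x = (if x = j then [j, i] else [x])"

text \<open>
  The generators \<open>\<phi>\<^sub>l\<close> and \<open>\<phi>\<^sub>r\<close> multiply \<open>a\<close> by \<open>b\<close>; conjugating them by a
  permutation that takes \<open>a\<close> to \<open>j\<close> and \<open>b\<close> to \<open>i\<close> gives all elementary maps.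
\<close>
lemma simple_map_conjugate:
  assumes ij: "i \<noteq> j" and f: "simple_map f"
    and f': "f Lb = [Lb]" "f Lc = [Lc]" "set (f La) \<subseteq> {La, Lb}"
  shows "simple_map (\<lambda>x. if x = j then map (\<lambda>y. if y = La then j else i) (f La) else [x])"
proof -
  obtain k where k: "k \<noteq> i" "k \<noteq> j" "UNIV = {i, j, k}"
    using other_letter[OF ij] .
  define \<pi> where "\<pi> = case_letter j i k"
  define \<pi>' where "\<pi>' x = (if x = j then La else if x = i then Lb else Lc)" for x
  have inj: "inj \<pi>" "inj \<pi>'"
    using ij k by (auto simp: inj_def \<pi>_def \<pi>'_def split: letter.splits)
  have "simple_map (\<lambda>x. subst (\<lambda>x. [\<pi> x]) (subst f [\<pi>' x]))"
    using simple_map_comp[OF simple_map_permutation[OF inj(1)] simple_map_comp[OF f simple_map_permutation[OF inj(2)]]] .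
  moreover have "subst (\<lambda>x. [\<pi> x]) u = map \<pi> u" for u
    by (induction u) auto
  moreover have "map \<pi> (f (\<pi>' x)) = (if x = j then map (\<lambda>y. if y = La then j else i) (f La) else [x])" for x
  proof -
    have "x \<in> {i, j, k}" using k(3) by blast
    moreover have "map \<pi> (f La) = map (\<lambda>y. if y = La then j else i) (f La)"
      using f'(3) by (auto simp: \<pi>_def)
    ultimately show ?thesis
      using f' ij k by (auto simp: \<pi>_def \<pi>'_def)
  qed
  ultimately show ?thesis
    by simp
qed

lemma simple_map_elementary:
  assumes "i \<noteq> j"
  shows "simple_map (mult_left i j)" "simple_map (mult_right i j)"
proof -
  have r: "simple_map (case_letter [La, Lb] [Lb] [Lc])"
    using simple_phir by (simp add: simple_map_def triple_eq_subst)
  show "simple_map (mult_left i j)" "simple_map (mult_right i j)"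
    using simple_map_conjugate[OF assms simple_map_generators(3)] simple_map_conjugate[OF assms r]
    by (simp_all add: mult_left_def[abs_def] mult_right_def[abs_def] cong: if_cong)
qed

section \<open>Conjugation by common prefixes\<close>

text \<open>
  \<open>k = I\<^sub>w \<circ> h\<close> with \<open>w = t\<^sup>-\<^sup>1\<close> and \<open>t\<close> a common prefix of the images under \<open>h\<close>:
  the prefix \<open>t\<close> is moved to the end of each image.
\<close>
definition rotates :: "'b list \<Rightarrow> ('a \<Rightarrow> 'b list) \<Rightarrow> ('a \<Rightarrow> 'b list) \<Rightarrow> bool" where
  "rotates t h k \<longleftrightarrow> (\<forall>x. prefix t (h x) \<and> h x @ t = t @ k x)"

lemma rotatesI: "(\<And>x. \<exists>y. h x = t @ y \<and> k x = y @ t) \<Longrightarrow> rotates t h k"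
  unfolding rotates_def by (metis append_assoc prefixI)

lemma rotatesD: "rotates t h k \<Longrightarrow> \<exists>y. h x = t @ y \<and> k x = y @ t"
  unfolding rotates_def by (metis append_assoc prefixE same_append_eq)

text \<open>
  Nonempty images keep the common prefix: an empty \<open>\<nu> x\<close> would give an image without it.
\<close>
lemma rotates_subst:
  assumes "rotates t h k" and "\<And>x. \<nu> x \<noteq> []"
  shows "rotates t (\<lambda>x. subst h (\<nu> x)) (\<lambda>x. subst k (\<nu> x))"
proof -
  have "subst h w @ t = t @ subst k w" for w
  proof (induction w)
    case (Cons x w)
    have "subst h (x # w) @ t = h x @ t @ subst k w"
      using Cons by simp
    also have "\<dots> = t @ subst k (x # w)"
      using assms(1) by (simp add: rotates_def append_assoc[symmetric] del: append_assoc)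
    finally show ?case .
  qed simp
  moreover have "prefix t (subst h (\<nu> x))" for x
    using assms by (cases "\<nu> x") (auto simp: rotates_def)
  ultimately show ?thesis
    by (simp add: rotates_def)
qed

definition rotation :: "('a \<Rightarrow> 'b list) \<Rightarrow> ('a \<Rightarrow> 'b list) \<Rightarrow> bool" where
  "rotation h k \<longleftrightarrow> (\<exists>t. rotates t h k \<or> rotates t k h)"

text \<open>
  The set of positive conjugates is linearly ordered: \<open>p\<close> and \<open>t\<close> are both suffixes of the
  images under \<open>h'\<close>, so one is a suffix of the other, and the difference rotates one of
  \<open>h\<close> and \<open>k\<close> into the other.
\<close>
lemma rotates_common_target:
  assumes "rotates p h h'" "rotates t k h'"
  shows "rotation h k"
proof -
  have suf: "suffix p (h' x)" "suffix t (h' x)" for x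
    using rotatesD[OF assms(1)] rotatesD[OF assms(2)] by (metis suffixI)+
  consider q where "p = q @ t" | q where "t = q @ p"
    using suffix_same_cases[OF suf] by (auto simp: suffix_def)
  then show ?thesis
  proof cases
    case 1
    have "rotates q h k"
    proof (rule rotatesI)
      fix x
      obtain y z where "h x = p @ y" "h' x = y @ p" "k x = t @ z" "h' x = z @ t"
        using rotatesD[OF assms(1)] rotatesD[OF assms(2)] by metis
      then show "\<exists>y. h x = q @ y \<and> k x = y @ q"
        using 1 by (intro exI[of _ "t @ y"]) auto
    qed
    then show ?thesis by (auto simp: rotation_def)
  next
    case 2
    have "rotates q k h"
    proof (rule rotatesI)
      fix x
      obtain y z where "h x = p @ y" "h' x = y @ p" "k x = t @ z" "h' x = z @ t"
        using rotatesD[OF assms(1)] rotatesD[OF assms(2)] by metis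
      then show "\<exists>y. k x = q @ y \<and> h x = y @ q"
        using 2 by (intro exI[of _ "p @ z"]) auto
    qed
    then show ?thesis by (auto simp: rotation_def)
  qed
qed

lemma rotates_common_source:
  assumes "rotates p h' h" "rotates t h' k"
  shows "rotation h k"
proof -
  have pre: "prefix p (h' x)" "prefix t (h' x)" for x
    using rotatesD[OF assms(1)] rotatesD[OF assms(2)] by (metis prefixI)+
  consider q where "p = t @ q" | q where "t = p @ q"
    using prefix_same_cases[OF pre] by (auto simp: prefix_def)
  then show ?thesis
  proof cases
    case 1
    have "rotates q k h"
    proof (rule rotatesI)
      fix x
      obtain y z where "h' x = p @ y" "h x = y @ p" "h' x = t @ z" "k x = z @ t"
        using rotatesD[OF assms(1)] rotatesD[OF assms(2)] by metis
      then show "\<exists>y. k x = q @ y \<and> h x = y @ q"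
        using 1 by (intro exI[of _ "y @ t"]) auto
    qed
    then show ?thesis by (auto simp: rotation_def)
  next
    case 2
    have "rotates q h k"
    proof (rule rotatesI)
      fix x
      obtain y z where "h' x = p @ y" "h x = y @ p" "h' x = t @ z" "k x = z @ t"
        using rotatesD[OF assms(1)] rotatesD[OF assms(2)] by metis
      then show "\<exists>y. h x = q @ y \<and> k x = y @ q"
        using 2 by (intro exI[of _ "z @ p"]) auto
    qed
    then show ?thesis by (auto simp: rotation_def)
  qed
qed

text \<open>
  Conjugation moves the fixed point along \<open>t\<close>. Once all letters fix the new point, so does
  \<open>t\<close>, and the two points are equal.
\<close>
lemma generating_rotates:
  fixes h k :: "'c \<Rightarrow> 'a list"
  assumes "rotates t h k \<or> rotates t k h" "generating (range h)"
  shows "generating (range k)"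
  unfolding generating_def
proof (intro allI impI)
  fix \<rho> :: "'a \<Rightarrow> nat \<times> 'a list \<Rightarrow> nat \<times> 'a list" and v x
  assume bij: "\<forall>x. bij (\<rho> x)" and fixed: "\<forall>w\<in>range k. fold \<rho> w v = v"
  have bijt: "bij (fold \<rho> t)"
    using bij by (intro bij_fold) auto
  (* u is the point that the words h y fix when the words k y fix v. *)
  obtain u where u: "if rotates t h k then fold \<rho> t u = v else fold \<rho> t v = u"
    using bijt by (metis bij_pointE)
  have "fold \<rho> (h y) u = u" for y
  proof (cases "rotates t h k")
    case True
    obtain z where z: "h y = t @ z" "k y = z @ t"
      using rotatesD[OF True] by blast
    have "fold \<rho> t (fold \<rho> z v) = fold \<rho> t u"
      using fixed True u z by (metis fold_append comp_apply rangeI)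
    then have "fold \<rho> z v = u"
      using bijt by (meson bij_is_inj injD)
    then show ?thesis
      using z u True by simp
  next
    case False
    then obtain z where z: "k y = t @ z" "h y = z @ t"
      using assms(1) rotatesD by metis
    then have "fold \<rho> z u = v"
      using fixed u False by (metis fold_append comp_apply rangeI)
    then show ?thesis
      using z u False by simp
  qed
  then have fixu: "\<rho> x u = u" for x
    using assms(2) bij unfolding generating_def by blast
  then have "fold \<rho> t u = u"
    by (induction t) auto
  then have "u = v"
    using u bijt by (metis bij_is_inj injD)
  then show "\<rho> x v = v"
    using fixu by simp
qed

lemma generating_factor:
  assumes "generating (range (\<lambda>x. subst h (\<nu> x)))"
  shows "generating (range h)"
  unfolding generating_def
proof (intro allI impI)
  fix \<rho> :: "'a \<Rightarrow> nat \<times> 'a list \<Rightarrow> nat \<times> 'a list" and v x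
  assume bij: "\<forall>x. bij (\<rho> x)" and "\<forall>w\<in>range h. fold \<rho> w v = v"
  then have "fold \<rho> (subst h w) v = v" for w
    by (induction w) auto
  then show "\<rho> x v = v"
    using assms bij unfolding generating_def by blast
qed

lemma generating_nonempty:
  fixes h :: "letter \<Rightarrow> letter list"
  assumes "generating (range h)"
  shows "h i \<noteq> []"
proof
  assume h: "h i = []"
  obtain j :: letter where "i \<noteq> j"
    by (metis letter.distinct(1))
  then obtain k where "UNIV = {i, j, k}"
    using other_letter by metis
  then have "range h = h ` {i, j, k}"
    by (rule arg_cong)
  then have "range h = {[], h j, h k}"
    using h by simp
  then have "generating {h j, h k}"
    using assms by (simp add: generating_def)
  then show False
    using not_generating_two by blast
qed

lemma generating_letters:
  assumes "generating (range (\<lambda>x. [\<pi> x]))"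
  shows "surj \<pi>"
proof (rule ccontr)
  assume "\<not> surj \<pi>"
  then obtain l where l: "\<And>x. \<pi> x \<noteq> l"
    by (metis surj_def)
  define \<rho> :: "'a \<Rightarrow> nat \<times> 'a list \<Rightarrow> nat \<times> 'a list" where "\<rho> x = (if x = l then toggle else id)" for x
  have "bij (\<rho> x)" for x
    by (simp add: \<rho>_def bij_toggle)
  moreover have "fold \<rho> [\<pi> x] (0, []) = (0, [])" for x
    using l by (simp add: \<rho>_def)
  ultimately have "\<rho> l (0, []) = (0, [])"
    using assms unfolding generating_def by blast
  then show False
    by (simp add: \<rho>_def toggle_def)
qed

section \<open>Reduction to a permutation of the letters\<close>

definition total_length :: "(letter \<Rightarrow> 'a list) \<Rightarrow> nat" where
  "total_length h = length (h La) + length (h Lb) + length (h Lc)"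

lemma total_length_update: "length w < length (h j) \<Longrightarrow> total_length (h(j := w)) < total_length h"
  by (cases j) (auto simp: total_length_def)

text \<open>
  \<open>I\<^sub>w \<circ> (h' \<circ> \<nu>) = (I\<^sub>w \<circ> h') \<circ> \<nu>\<close>, and a common prefix or suffix for \<open>h'\<close> is one for \<open>h' \<circ> \<nu>\<close>.
\<close>
lemma simple_rotation_factor:
  assumes h: "h = (\<lambda>x. subst h' (\<nu> x))" and \<nu>: "simple_map \<nu>" "\<And>x. \<nu> x \<noteq> []"
    and ex: "\<exists>k. rotation h' k \<and> simple_map k"
  shows "\<exists>k. rotation h k \<and> simple_map k"
proof -
  obtain k where k: "rotation h' k" "simple_map k"
    using ex by blast
  then have "rotation h (\<lambda>x. subst k (\<nu> x))"
    using rotates_subst[where \<nu> = \<nu>, OF _ \<nu>(2)] unfolding rotation_def h by blast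
  then show ?thesis
    using simple_map_comp[OF k(2) \<nu>(1)] by blast
qed

lemma simple_rotation_if_prefix:
  assumes gen: "generating (range h)" and ij: "i \<noteq> j" and pre: "prefix (h i) (h j)"
    and IH: "\<And>h'. total_length h' < total_length h \<Longrightarrow> generating (range h') \<Longrightarrow> \<exists>k. rotation h' k \<and> simple_map k"
  shows "\<exists>k. rotation h k \<and> simple_map k"
proof -
  obtain r where r: "h j = h i @ r"
    using pre by (auto simp: prefix_def)
  have h: "h = (\<lambda>x. subst (h(j := r)) (mult_left i j x))"
    using r ij by (auto simp: mult_left_def)
  have "total_length (h(j := r)) < total_length h"
    using generating_nonempty[OF gen, of i] r by (intro total_length_update) auto
  moreover have "generating (range (h(j := r)))"
    by (rule generating_factor[of _ "mult_left i j"]) (simp only: gen h[symmetric])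
  ultimately show ?thesis
    by (intro simple_rotation_factor[OF h simple_map_elementary(1)[OF ij]] IH) (auto simp: mult_left_def)
qed

lemma simple_rotation_if_suffix:
  assumes gen: "generating (range h)" and ij: "i \<noteq> j" and suf: "suffix (h i) (h j)"
    and IH: "\<And>h'. total_length h' < total_length h \<Longrightarrow> generating (range h') \<Longrightarrow> \<exists>k. rotation h' k \<and> simple_map k"
  shows "\<exists>k. rotation h k \<and> simple_map k"
proof -
  obtain r where r: "h j = r @ h i"
    using suf by (auto simp: suffix_def)
  have h: "h = (\<lambda>x. subst (h(j := r)) (mult_right i j x))"
    using r ij by (auto simp: mult_right_def)
  have "total_length (h(j := r)) < total_length h"
    using generating_nonempty[OF gen, of i] r by (intro total_length_update) auto
  moreover have "generating (range (h(j := r)))"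
    by (rule generating_factor[of _ "mult_right i j"]) (simp only: gen h[symmetric])
  ultimately show ?thesis
    by (intro simple_rotation_factor[OF h simple_map_elementary(2)[OF ij]] IH) (auto simp: mult_right_def)
qed

lemma longest_common_prefix:
  fixes h :: "'c \<Rightarrow> 'a list"
  obtains p y where "\<And>x. h x = p @ y x" "\<not> (\<exists>l. \<forall>x. \<exists>z. y x = l # z)"
proof -
  have "\<exists>p y. (\<forall>x. h x = p @ y x) \<and> \<not> (\<exists>l. \<forall>x. \<exists>z. y x = l # z)"
  proof (induction "length (h undefined)" arbitrary: h rule: less_induct)
    case less
    show ?case
    proof (cases "\<exists>l. \<forall>x. \<exists>z. h x = l # z")
      case True
      then obtain l z where z: "\<And>x. h x = l # z x"
        by metis
      then obtain p y where "\<forall>x. z x = p @ y x" "\<not> (\<exists>l. \<forall>x. \<exists>z. y x = l # z)"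
        using less.hyps[of z] by auto
      then show ?thesis
        using z by (intro exI[of _ "l # p"] exI[of _ y]) simp
    next
      case False
      then show ?thesis
        by (intro exI[of _ "[]"] exI[of _ h]) simp
    qed
  qed
  then show thesis
    using that by blast
qed

lemma longest_common_suffix:
  fixes h :: "'c \<Rightarrow> 'a list"
  obtains s y where "\<And>x. h x = y x @ s" "\<not> (\<exists>l. \<forall>x. \<exists>z. y x = z @ [l])"
proof -
  obtain p y where p: "\<And>x. rev (h x) = p @ y x" and y: "\<not> (\<exists>l. \<forall>x. \<exists>z. y x = l # z)"
    using longest_common_prefix[of "\<lambda>x. rev (h x)"] by blast
  have "h x = rev (y x) @ rev p" for x
    using p[of x] by (metis rev_append rev_rev_ident)
  moreover have "\<not> (\<exists>l. \<forall>x. \<exists>z. rev (y x) = z @ [l])"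
    using y by (metis rev_eq_Cons_iff rev_rev_ident)
  ultimately show thesis
    using that[of "\<lambda>x. rev (y x)" "rev p"] by blast
qed

lemma rotates_Nil [simp]: "rotates [] h k \<longleftrightarrow> k = h"
  by (auto simp: rotates_def fun_eq_iff)

text \<open>
  With \<open>h(x) = p z\<^sub>x s\<close>, the maps \<open>h0 = z s p\<close> and \<open>h1 = s p z\<close> are the extreme conjugates.
  The induction hypothesis gives a conjugate of \<open>h0\<close> or \<open>h1\<close> that is simple. Since the
  images of \<open>h0\<close> have no common first letter and those of \<open>h1\<close> no common last letter, that
  conjugation can go in one direction only, and this is the direction in which it can be combined
  with the conjugation that connects \<open>h\<close> with \<open>h0\<close> or \<open>h1\<close>.
\<close>
theorem ex_simple_rotation:
  assumes "generating (range h)"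
  shows "\<exists>k. rotation h k \<and> simple_map k"
  using assms
proof (induction "total_length h" arbitrary: h rule: less_induct)
  case less
  note gen = less.prems and IH = less.hyps
  show ?case
  proof (cases "\<exists>i j. i \<noteq> j \<and> prefix (h i) (h j)")
    case True
    then show ?thesis
      using simple_rotation_if_prefix[OF gen _ _ IH] by blast
  next
    case h_code: False
    obtain p y where y: "\<And>x. h x = p @ y x" and y_hd: "\<not> (\<exists>l. \<forall>x. \<exists>z. y x = l # z)"
      using longest_common_prefix[of h] by metis
    have two: "\<exists>j. i \<noteq> j" for i :: letter
      by (metis letter.distinct(1))
    have y_ne: "y x \<noteq> []" for x
      using h_code two[of x] y by (metis append_Nil2 prefixI)
    define h0 where "h0 x = y x @ p" for x
    have h0: "rotates p h h0"
      by (rule rotatesI) (simp add: y h0_def)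
    have gen0: "generating (range h0)"
      using generating_rotates[OF _ gen] h0 by blast
    have total0: "total_length h0 = total_length h"
      by (simp add: total_length_def y h0_def)
    show ?thesis
    proof (cases "\<exists>i j. i \<noteq> j \<and> suffix (h0 i) (h0 j)")
      case True
      then obtain k where k: "rotation h0 k" "simple_map k"
        using simple_rotation_if_suffix[OF gen0 _ _ IH[folded total0]] by blast
      then obtain t where t: "rotates t h0 k \<or> rotates t k h0"
        by (auto simp: rotation_def)
      (* A nonempty t cannot be a common prefix of the images under h0. *)
      have "rotates t k h0"
      proof (rule ccontr)
        assume no: "\<not> rotates t k h0"
        then have t': "rotates t h0 k"
          using t by blast
        show False
        proof (cases t)
          case Nil
          then show False using no t' by simp
        next
          case (Cons l t'')
          have "\<exists>z. y x = l # z" for x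
            using rotatesD[OF t', of x] y_ne[of x] Cons by (cases "y x") (auto simp: h0_def)
          then show False
            using y_hd by blast
        qed
      qed
      then show ?thesis
        using rotates_common_target[OF h0] k(2) by blast
    next
      case h0_code: False
      obtain s z where z: "\<And>x. y x = z x @ s" and z_last: "\<not> (\<exists>l. \<forall>x. \<exists>w. z x = w @ [l])"
        using longest_common_suffix[of y] by metis
      have z_ne: "z x \<noteq> []" for x
      proof
        assume "z x = []"
        then have "suffix (h0 x) (h0 j)" for j
          by (simp add: h0_def z suffix_def)
        then show False
          using h0_code two[of x] by blast
      qed
      define h1 where "h1 x = s @ p @ z x" for x
      have h1: "rotates s h1 h"
        by (rule rotatesI) (simp add: y z h1_def)
      have gen1: "generating (range h1)"
        using generating_rotates[OF _ gen] h1 by blast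
      have total1: "total_length h1 = total_length h"
        by (simp add: total_length_def y z h1_def)
      show ?thesis
      proof (cases "\<exists>i j. i \<noteq> j \<and> prefix (z i) (z j)")
        case True
        then have "\<exists>i j. i \<noteq> j \<and> prefix (h1 i) (h1 j)"
          by (simp add: h1_def)
        then obtain k where k: "rotation h1 k" "simple_map k"
          using simple_rotation_if_prefix[OF gen1 _ _ IH[folded total1]] by blast
        then obtain t where t: "rotates t h1 k \<or> rotates t k h1"
          by (auto simp: rotation_def)
        have "rotates t h1 k"
        proof (rule ccontr)
          assume no: "\<not> rotates t h1 k"
          then have t': "rotates t k h1"
            using t by blast
          show False
          proof (cases t rule: rev_cases)
            case Nil
            then show False using no t' by simp
          next
            case (snoc t'' l)
            have "\<exists>w. z x = w @ [l]" for x
              using rotatesD[OF t', of x] z_ne[of x] snoc by (cases "z x" rule: rev_cases) (auto simp: h1_def)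
            then show False
              using z_last by blast
          qed
        qed
        then show ?thesis
          using rotates_common_source[OF h1] k(2) by blast
      next
        case z_code: False
        have "range h1 = {(s @ p) @ z La, (s @ p) @ z Lb, (s @ p) @ z Lc}"
          by (simp add: letter_UNIV h1_def)
        moreover have "code3 (z La) (z Lb) (z Lc)"
          using z_code by (auto simp: code3_def)
        moreover have "code3 (rev (z La)) (rev (z Lb)) (rev (z Lc))"
          using h0_code by (auto simp: code3_def h0_def z suffix_to_prefix[symmetric])
        moreover have "\<not> (hd (z La) = hd (z Lb) \<and> hd (z Lb) = hd (z Lc))"
        proof
          assume *: "hd (z La) = hd (z Lb) \<and> hd (z Lb) = hd (z Lc)"
          have "\<exists>w. y x = hd (z La) # w" for x
            using z_ne[of x] * by (cases x; cases "z x") (auto simp: z)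
          then show False using y_hd by blast
        qed
        moreover have "\<not> (last (z La) = last (z Lb) \<and> last (z Lb) = last (z Lc))"
        proof
          assume *: "last (z La) = last (z Lb) \<and> last (z Lb) = last (z Lc)"
          have "\<exists>w. z x = w @ [last (z La)]" for x
            using z_ne[of x] * by (cases x) (metis append_butlast_last_id)+
          then show False using z_last by blast
        qed
        ultimately have "s @ p = [] \<and> length (z La) = 1 \<and> length (z Lb) = 1 \<and> length (z Lc) = 1"
          using generating_bifix_code[of "s @ p" "z La" "z Lb" "z Lc"] gen1 by simp
        then have "length (h x) = 1" for x
          by (cases x) (simp_all add: y z)
        then have h: "h = (\<lambda>x. [hd (h x)])"
          by (metis One_nat_def length_0_conv length_Suc_conv list.sel(1))
        then have "surj (\<lambda>x. hd (h x))"
          using gen generating_letters by metis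
        moreover have "finite (UNIV :: letter set)"
          by (simp add: letter_UNIV)
        ultimately have "inj (\<lambda>x. hd (h x))"
          by (simp add: finite_UNIV_surj_inj)
        then have "simple_map h"
          using simple_map_permutation h by metis
        moreover have "rotation h h"
          unfolding rotation_def by (intro exI[of _ "[]"]) simp
        ultimately show ?thesis by blast
      qed
    qed
  qed
qed

section \<open>Invertible substitutions\<close>

lemma substitution_eq_subst: "substitution \<sigma> \<Longrightarrow> \<sigma> = subst (\<lambda>x. \<sigma> [x])"
proof
  assume \<sigma>: "substitution \<sigma>"
  show "\<sigma> w = subst (\<lambda>x. \<sigma> [x]) w" for w
  proof (induction w)
    case (Cons x w)
    then show ?case
      using \<sigma> by (metis append_Cons append_Nil substitution_def subst_simps(2))
  qed (use \<sigma> in \<open>simp add: substitution_def\<close>)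
qed

lemma inner_aut_hom:
  assumes w: "w \<in> carrier free_group"
  shows "inner_aut w \<in> hom free_group free_group"
proof -
  interpret group free_group by (rule group_free_group)
  show ?thesis
    using w by (intro homI) (simp_all add: inner_aut_def m_assoc inv_solve_left flip: m_assoc, simp add: m_assoc)
qed

text \<open>Both sides are homomorphisms, so it suffices to compare them on the letters.\<close>
lemma inner_aut_free_extend_simple:
  assumes w: "w \<in> carrier free_group" and k: "simple_map k"
    and conj: "\<And>x. inner_aut w (pos (\<sigma> [x])) = pos (k x)" and \<sigma>: "substitution \<sigma>"
  shows "is_simple_substitution (inner_aut w \<circ> free_extend \<sigma>)"
  unfolding is_simple_substitution_def
proof (intro bexI ballI)
  show simple: "subst k \<in> simple_substitutions"
    using k by (simp add: simple_map_def)
  fix x :: "letter signed list"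
  assume x: "x \<in> carrier free_group"
  show "(inner_aut w \<circ> free_extend \<sigma>) x = free_extend (subst k) x"
  proof (rule hom_free_group_eqI[OF _ free_extend_hom _ x])
    show "inner_aut w \<circ> free_extend \<sigma> \<in> hom free_group free_group"
      using hom_compose[OF free_extend_hom inner_aut_hom[OF w]] .
    show "(inner_aut w \<circ> free_extend \<sigma>) (pos [y]) = free_extend (subst k) (pos [y])" for y
      using conj[of y] free_extend_pos[OF \<sigma>] free_extend_pos[OF simple_substitution_substitution[OF simple]]
      by simp
  qed
qed

theorem theorem3p1:
  fixes \<sigma> :: "letter list \<Rightarrow> letter list"
  assumes "invertible_substitution \<sigma>"
  shows "(\<exists>w\<in>carrier free_group.
            (w \<in> positive_words \<or> inv\<^bsub>free_group\<^esub> w \<in> positive_words) \<and>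
            is_simple_substitution (inner_aut w \<circ> free_extend \<sigma>)) \<and>
         (\<exists>w\<in>carrier free_group.
            (w \<in> positive_words \<or> inv\<^bsub>free_group\<^esub> w \<in> positive_words) \<and>
            is_simple_substitution (inner_aut w \<circ> free_extend \<sigma>) \<and>
            ((\<exists>u. w = pos u \<and> (\<forall>x. suffix u (\<sigma> [x]))) \<or>
             (\<exists>u. inv\<^bsub>free_group\<^esub> w = pos u \<and> (\<forall>x. prefix u (\<sigma> [x])))))"
proof -
  interpret G: group "free_group :: letter signed list monoid"
    by (rule group_free_group)
  have \<sigma>: "substitution \<sigma>"
    using assms by (simp add: invertible_substitution_def)
  obtain k t where k: "simple_map k" and t: "rotates t (\<lambda>x. \<sigma> [x]) k \<or> rotates t k (\<lambda>x. \<sigma> [x])"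
    using ex_simple_rotation[OF generating_invertible[OF assms]] unfolding rotation_def by blast
  have "\<exists>w\<in>carrier free_group. is_simple_substitution (inner_aut w \<circ> free_extend \<sigma>) \<and>
    ((\<exists>u. w = pos u \<and> (\<forall>x. suffix u (\<sigma> [x]))) \<or>
     (\<exists>u. inv\<^bsub>free_group\<^esub> w = pos u \<and> (\<forall>x. prefix u (\<sigma> [x]))))"
    using t
  proof
    assume t: "rotates t (\<lambda>x. \<sigma> [x]) k"
    define w where "w = inv\<^bsub>free_group\<^esub> pos t"
    have w: "w \<in> carrier free_group" "inv\<^bsub>free_group\<^esub> w = pos t"
      by (simp_all add: w_def pos_in_carrier)
    have "inner_aut w (pos (\<sigma> [x])) = pos (k x)" for x
    proof -
      obtain y where "\<sigma> [x] = t @ y" "k x = y @ t"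
        using rotatesD[OF t, of x] by blast
      then show ?thesis
        by (simp add: inner_aut_def w(2)) (simp add: w_def pos_append pos_in_carrier flip: G.m_assoc)
    qed
    then have "is_simple_substitution (inner_aut w \<circ> free_extend \<sigma>)"
      using inner_aut_free_extend_simple[OF w(1) k _ \<sigma>] by blast
    moreover have "prefix t (\<sigma> [x])" for x
      using t by (simp add: rotates_def)
    ultimately show ?thesis
      using w by blast
  next
    assume t: "rotates t k (\<lambda>x. \<sigma> [x])"
    have "inner_aut (pos t) (pos (\<sigma> [x])) = pos (k x)" for x
    proof -
      obtain y where "k x = t @ y" "\<sigma> [x] = y @ t"
        using rotatesD[OF t, of x] by blast
      then show ?thesis
        by (simp add: inner_aut_def pos_append pos_in_carrier G.m_assoc)
    qed
    then have "is_simple_substitution (inner_aut (pos t) \<circ> free_extend \<sigma>)"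
      using inner_aut_free_extend_simple[OF pos_in_carrier k _ \<sigma>] by blast
    moreover have "suffix t (\<sigma> [x])" for x
      using rotatesD[OF t, of x] by (auto simp: suffix_def)
    ultimately show ?thesis
      using pos_in_carrier by blast
  qed
  then show ?thesis
    unfolding positive_words_def by blast
qed

end
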